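(* Let $n\ge 2$, let $F:\mathbb{R}^n\to\mathbb{R}^n$ be differentiable with Jacobian $J(x)$, and let $x^*$ satisfy $F(x^* )=0$. Suppose there is a constant $M\ge 0$ such that $\|J(x)-J(x^* )\|\le M\|x-x^*\|$ for all $x\in\mathbb{R}^n$, and suppose $J_*:=J(x^* )$ is nonsingular; put $c=\|J_*^{-1}\|$. Let $(x_k,B_k)_{k\ge0}$ be generated by the random Broyden's method (defined in the context) from deterministic $x_0\in\mathbb{R}^n$, $B_0\in\mathbb{R}^{n\times n}$, and assume the iteration is well defined, i.e. $B_k$ is nonsingular for all $k$. Suppose $$48\sqrt{n}\,cM\|x_0-x^*\|+c\|B_0-J(x_0)\|\le\frac13.$$ Then for every $0<\delta<1$, with probability at least $1-\delta$ the following hold: $$\|x_k-x^*\|\le\Big(\frac{4n^2e}{\delta}\Big)^k\Big(1-\frac1{n+1}\Big)^{k(k-1)/4}\|x_0-x^*\|\quad\text{for all }k\ge1,$$ and $$\|B_k-J_*\|_F\le\frac{8n^2c^{-1}e}{\delta}\Big(1-\frac1{n+1}\Big)^{k/2}\quad\text{for all }k\ge 4(n+1)\ln\frac{4n^2e}{\delta}+3.$$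
   Context: $\|\cdot\|$ is the Euclidean norm for vectors and the spectral (induced 2-) norm for matrices; $\|\cdot\|_F$ is the Frobenius norm; $e_1,\dots,e_n$ is the standard basis of $\mathbb{R}^n$; the scalar $e$ is Euler's number. Random Broyden's method: given $x_0$ and $B_0$, for $k=0,1,2,\dots$ set $$x_{k+1}=x_k-B_k^{-1}F(x_k),$$ draw $u_k$ uniformly from $\{e_1,\dots,e_n\}$, independently of the previous directions, and set $$B_{k+1}=B_k+\frac{(J(x_{k+1})u_k-B_ku_k)u_k^\top}{u_k^\top u_k}.$$ *)

theory Defs
  imports "HOL-Analysis.Analysis" "HOL-Probability.Probability"
begin

definition spectral_norm :: "real ^ 'n ^ 'm \<Rightarrow> real" where
  "spectral_norm A = onorm (\<lambda>v. A *v v)"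

definition frobenius_norm :: "real ^ 'n ^ 'm \<Rightarrow> real" where
  "frobenius_norm A = sqrt (\<Sum>i\<in>UNIV. \<Sum>j\<in>UNIV. (A $ i $ j)\<^sup>2)"

definition outer_product :: "real ^ 'm \<Rightarrow> real ^ 'n \<Rightarrow> real ^ 'n ^ 'm" where
  "outer_product v w = (\<chi> i j. v $ i * w $ j)"

(* One realisation of the method, for a given sequence of directions u.
   If some B k is singular, matrix_inv (B k) is an unspecified matrix; the
   recursion is meaningful only together with invertibility of every B k. *)
definition broyden_iterates ::
  "(real ^ 'n \<Rightarrow> real ^ 'n) \<Rightarrow> (real ^ 'n \<Rightarrow> real ^ 'n ^ 'n) \<Rightarrow> real ^ 'n \<Rightarrow> real ^ 'n ^ 'n \<Rightarrow>
   (nat \<Rightarrow> real ^ 'n) \<Rightarrow> (nat \<Rightarrow> real ^ 'n) \<Rightarrow> (nat \<Rightarrow> real ^ 'n ^ 'n) \<Rightarrow> bool" where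
  "broyden_iterates F J x0 B0 u x B \<longleftrightarrow>
     x 0 = x0 \<and> B 0 = B0 \<and>
     (\<forall>k. x (Suc k) = x k - matrix_inv (B k) *v F (x k) \<and>
          B (Suc k) = B k + (1 / (u k \<bullet> u k)) *\<^sub>R
            outer_product (J (x (Suc k)) *v u k - B k *v u k) (u k))"

(* Basis is the standard basis e_1, ..., e_n of R^n.  Since the target space is
   count_space Basis, measurability includes that u k takes its values in Basis. *)
definition random_directions :: "'w measure \<Rightarrow> (nat \<Rightarrow> 'w \<Rightarrow> real ^ 'n) \<Rightarrow> bool" where
  "random_directions P u \<longleftrightarrow>
     prob_space.indep_vars P (\<lambda>_. count_space Basis) u UNIV \<and>
     (\<forall>k. distr P (count_space Basis) (u k) = uniform_count_measure Basis)"

definition random_broyden ::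
  "'w measure \<Rightarrow> (real ^ 'n \<Rightarrow> real ^ 'n) \<Rightarrow> (real ^ 'n \<Rightarrow> real ^ 'n ^ 'n) \<Rightarrow>
   real ^ 'n \<Rightarrow> real ^ 'n ^ 'n \<Rightarrow>
   (nat \<Rightarrow> 'w \<Rightarrow> real ^ 'n) \<Rightarrow> (nat \<Rightarrow> 'w \<Rightarrow> real ^ 'n) \<Rightarrow> (nat \<Rightarrow> 'w \<Rightarrow> real ^ 'n ^ 'n) \<Rightarrow> bool" where
  "random_broyden P F J x0 B0 u x B \<longleftrightarrow>
     random_directions P u \<and>
     (\<forall>\<omega>\<in>space P.
        broyden_iterates F J x0 B0 (\<lambda>k. u k \<omega>) (\<lambda>k. x k \<omega>) (\<lambda>k. B k \<omega>))"

end

theory Submission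
  imports Defs
begin

text \<open>
  Write \<open>D\<^sub>k = B\<^sub>k - J(x*)\<close>, let \<open>\<sigma>\<^sub>k\<close> and \<open>s\<^sub>k\<close> be \<open>c\<close> times the spectral and the Frobenius norm of
  \<open>D\<^sub>k\<close>, and \<open>\<rho>\<^sub>k = c M \<parallel>x\<^sub>k - x*\<parallel>\<close>. Two facts about a single step, valid for every direction,
  reduce the theorem to a supermartingale estimate.

  The first is stability (\<open>safe_broyden_step\<close>): the inequality \<open>\<sigma>\<^sub>k + 2 \<rho>\<^sub>k \<le> 1/3\<close> is preserved.
  It makes \<open>B\<^sub>k\<close> a small relative perturbation of \<open>J(x*)\<close>, so the quasi-Newton step satisfies
  \<open>\<parallel>x\<^sub>k\<^sub>+\<^sub>1 - x*\<parallel> \<le> 3/2 (\<sigma>\<^sub>k + \<rho>\<^sub>k) \<parallel>x\<^sub>k - x*\<parallel>\<close>, which is at most half of \<open>\<parallel>x\<^sub>k - x*\<parallel>\<close>. On the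
  other hand \<open>\<sigma>\<close> grows by at most \<open>\<rho>\<^sub>k\<^sub>+\<^sub>1\<close>, and the halving of \<open>\<rho>\<close> pays for that.

  The second is drift (\<open>sum_potential_broyden_step\<close>): an update along \<open>e\<^sub>j\<close> replaces column \<open>j\<close> of
  \<open>D\<^sub>k\<close> by that of \<open>J(x\<^sub>k\<^sub>+\<^sub>1) - J(x*)\<close>. Averaged over \<open>j\<close>, this removes the fraction \<open>1/n\<close> of \<open>s\<^sub>k\<^sup>2\<close>
  and adds at most \<open>\<rho>\<^sub>k\<^sub>+\<^sub>1\<^sup>2 \<le> \<rho>\<^sub>k\<^sup>2/4\<close>. Hence \<open>V\<^sub>k = s\<^sub>k\<^sup>2 + \<rho>\<^sub>k\<^sup>2\<close> shrinks on average by the factor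
  \<open>1 - 1/n\<close>, and since the next direction is independent of the past,
  \<open>E V\<^sub>k \<le> (1 - 1/n)\<^sup>k V\<^sub>0\<close> with \<open>V\<^sub>0 \<le> n\<close>.

  The claimed rate \<open>Q = 1 - 1/(n+1)\<close> is slightly worse than \<open>1 - 1/n\<close>, with
  \<open>(1 - 1/n)/Q = 1 - 1/n\<^sup>2\<close>. Markov's inequality at the levels \<open>(n\<^sup>2/\<delta>)\<^sup>2 Q\<^sup>k\<close> and a union bound over
  all \<open>k\<close>, a geometric series with sum \<open>n\<^sup>2\<close>, show that \<open>V\<^sub>k \<le> (n\<^sup>2/\<delta>)\<^sup>2 Q\<^sup>k\<close> for all \<open>k\<close> at once
  outside an event of probability at most \<open>\<delta>\<close> (\<open>prob_exceed_geometric\<close>). There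
  \<open>s\<^sub>k \<le> (n\<^sup>2/\<delta>) Q\<^sup>k\<^sup>/\<^sup>2\<close>, which is the matrix bound, and
  \<open>\<sigma>\<^sub>k + \<rho>\<^sub>k \<le> 2 (n\<^sup>2/\<delta>) Q\<^sup>k\<^sup>/\<^sup>2\<close>; multiplying the one-step error bounds gives the exponent
  \<open>0/2 + 1/2 + \<dots> + (k-1)/2 = k(k-1)/4\<close> of \<open>Q\<close> in the bound for the iterates.
\<close>

section \<open>Two matrix norms\<close>

lemma norm_matrix_vector_le: "norm (A *v v) \<le> spectral_norm A * norm v"
  unfolding spectral_norm_def by (rule onorm[OF matrix_vector_mul_bounded_linear])

lemma spectral_norm_nonneg: "0 \<le> spectral_norm A"
  unfolding spectral_norm_def by (rule onorm_pos_le[OF matrix_vector_mul_bounded_linear])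

lemma spectral_norm_leI:
  assumes "\<And>v. norm (A *v v) \<le> b * norm v"
  shows "spectral_norm A \<le> b"
  unfolding spectral_norm_def by (rule onorm_le[OF assms])

lemma spectral_norm_triangle: "spectral_norm (A + B) \<le> spectral_norm A + spectral_norm B"
proof (rule spectral_norm_leI)
  fix v
  have "norm ((A + B) *v v) \<le> norm (A *v v) + norm (B *v v)"
    by (simp add: matrix_vector_mult_add_rdistrib norm_triangle_ineq)
  also have "\<dots> \<le> (spectral_norm A + spectral_norm B) * norm v"
    using norm_matrix_vector_le[of A v] norm_matrix_vector_le[of B v] by (simp add: distrib_right)
  finally show "norm ((A + B) *v v) \<le> (spectral_norm A + spectral_norm B) * norm v" .
qed

lemma frobenius_norm_eq_norm: "frobenius_norm A = norm A"
  by (simp add: frobenius_norm_def norm_vec_def L2_set_def sum_nonneg)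

lemma Basis_vec_eq_range_axis: "(Basis :: (real ^ 'n) set) = range (\<lambda>i. axis i 1)"
  by (auto simp: Basis_vec_def)

lemma norm_matrix_sq_eq_sum_Basis:
  fixes A :: "real ^ 'n ^ 'm"
  shows "(norm A)\<^sup>2 = (\<Sum>b\<in>Basis. (norm (A *v b))\<^sup>2)"
proof -
  have inj: "inj (\<lambda>i::'n. axis i (1::real))"
    by (auto simp: inj_on_def axis_eq_axis)
  have "(\<Sum>b\<in>Basis. (norm (A *v b))\<^sup>2) = (\<Sum>j\<in>UNIV. (norm (column j A))\<^sup>2)"
    by (simp add: Basis_vec_eq_range_axis sum.reindex[OF inj] matrix_vector_mult_basis)
  also have "\<dots> = (\<Sum>j\<in>UNIV. \<Sum>i\<in>UNIV. (A $ i $ j)\<^sup>2)"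
    by (simp add: norm_vec_def L2_set_def sum_nonneg column_def)
  also have "\<dots> = (\<Sum>i\<in>UNIV. \<Sum>j\<in>UNIV. (A $ i $ j)\<^sup>2)"
    by (rule sum.swap)
  also have "\<dots> = (norm A)\<^sup>2"
    by (simp add: norm_vec_def L2_set_def sum_nonneg)
  finally show ?thesis by simp
qed

lemma spectral_norm_le_norm: "spectral_norm A \<le> norm A"
proof (rule spectral_norm_leI)
  fix v
  have "(norm (A *v v))\<^sup>2 = (\<Sum>i\<in>UNIV. (A $ i \<bullet> v)\<^sup>2)"
    by (simp add: norm_vec_def L2_set_def sum_nonneg matrix_mult_dot)
  also have "\<dots> \<le> (\<Sum>i\<in>UNIV. (norm (A $ i))\<^sup>2 * (norm v)\<^sup>2)"
    by (intro sum_mono) (metis Cauchy_Schwarz_ineq2 abs_le_square_iff abs_mult abs_norm_cancel power_mult_distrib)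
  also have "\<dots> = (norm A * norm v)\<^sup>2"
    by (simp add: norm_vec_def[of A] L2_set_def sum_nonneg power_mult_distrib sum_distrib_right)
  finally show "norm (A *v v) \<le> norm A * norm v"
    by (rule power2_le_imp_le) simp
qed

text \<open>
  Each of the columns has Euclidean norm at most the spectral norm. This is where the
  hypothesis on the initial spectral error becomes a bound on the potential below, at the price
  of a factor \<open>n\<close>.
\<close>

lemma norm_sq_le_card_spectral_norm_sq:
  fixes A :: "real ^ 'n ^ 'm"
  shows "(norm A)\<^sup>2 \<le> CARD('n) * (spectral_norm A)\<^sup>2"
proof -
  have "(norm (A *v b))\<^sup>2 \<le> (spectral_norm A)\<^sup>2" if "b \<in> Basis" for b
    using norm_matrix_vector_le[of A b] that by (intro power_mono) auto
  then have "(\<Sum>b\<in>Basis. (norm (A *v b))\<^sup>2) \<le> (\<Sum>b\<in>(Basis :: (real ^ 'n) set). (spectral_norm A)\<^sup>2)"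
    by (intro sum_mono)
  then show ?thesis
    by (simp add: norm_matrix_sq_eq_sum_Basis)
qed

lemma outer_product_vector_mult: "outer_product v w *v z = (w \<bullet> z) *\<^sub>R v"
  by (simp add: vec_eq_iff outer_product_def matrix_vector_mult_def inner_vec_def sum_distrib_left
      ac_simps)

lemma matrix_inv_mult_left:
  fixes A :: "real ^ 'n ^ 'n"
  assumes "invertible A" shows "matrix_inv A *v (A *v v) = v"
proof -
  have "matrix_inv A ** A = mat 1"
    using assms unfolding invertible_def matrix_inv_def by (rule someI2_ex) auto
  then show ?thesis by (simp add: matrix_vector_mul_assoc)
qed

lemma matrix_inv_mult_right:
  fixes A :: "real ^ 'n ^ 'n"
  assumes "invertible A" shows "A *v (matrix_inv A *v v) = v"
proof -
  have "A ** matrix_inv A = mat 1"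
    using assms unfolding invertible_def matrix_inv_def by (rule someI2_ex) auto
  then show ?thesis by (simp add: matrix_vector_mul_assoc)
qed

section \<open>One step near a root\<close>

locale lipschitz_root =
  fixes F :: "real ^ 'n \<Rightarrow> real ^ 'n" and J :: "real ^ 'n \<Rightarrow> real ^ 'n ^ 'n"
    and xs :: "real ^ 'n" and M :: real
  assumes deriv: "\<And>y. (F has_derivative (\<lambda>h. J y *v h)) (at y)"
    and root: "F xs = 0"
    and M_nonneg: "0 \<le> M"
    and lip: "\<And>y. spectral_norm (J y - J xs) \<le> M * norm (y - xs)"
    and inv: "invertible (J xs)"
begin

definition c :: real where "c = spectral_norm (matrix_inv (J xs))"

lemma norm_le_inverse_bound: "norm v \<le> c * norm (J xs *v v)"
  using norm_matrix_vector_le[of "matrix_inv (J xs)" "J xs *v v"] inv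
  by (simp add: c_def matrix_inv_mult_left)

lemma c_pos: "0 < c"
proof -
  obtain v :: "real ^ 'n" where "v \<in> Basis" using nonempty_Basis by blast
  then have "1 \<le> c * norm (J xs *v v)"
    using norm_le_inverse_bound[of v] by simp
  then have "c \<noteq> 0" by auto
  then show ?thesis
    using spectral_norm_nonneg[of "matrix_inv (J xs)"] by (simp add: c_def)
qed

text \<open>
  The mean value inequality on the ball around the root through \<open>y\<close>. The sharp constant would be
  \<open>M/2\<close>; the constants of the final bounds leave room for \<open>M\<close>, which needs no integral along the
  segment.
\<close>

lemma linearization_error: "norm (F y - J xs *v (y - xs)) \<le> M * norm (y - xs) * norm (y - xs)"
proof -
  have seg: "norm (xs + t *\<^sub>R (y - xs) - xs) \<le> norm (y - xs)" if "t \<in> {0..1}" for t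
    using that mult_right_mono[of "\<bar>t\<bar>" 1 "norm (y - xs)"] by simp
  have "norm (F y - F xs - J xs *v (y - xs)) \<le> norm (y - xs) * (M * norm (y - xs))"
  proof (rule differentiable_bound_linearization[where S = "cball xs (norm (y - xs))"
          and f' = "\<lambda>z h. J z *v h"])
    show "xs + t *\<^sub>R (y - xs) \<in> cball xs (norm (y - xs))" if "t \<in> {0..1}" for t
      using seg[OF that] by (simp add: dist_norm norm_minus_commute)
    show "(F has_derivative (*v) (J z)) (at z within cball xs (norm (y - xs)))" for z
      using deriv[of z] by (rule has_derivative_at_withinI)
    show "onorm ((*v) (J z) - (*v) (J xs)) \<le> M * norm (y - xs)"
      if "z \<in> cball xs (norm (y - xs))" for z
    proof -
      have "onorm ((*v) (J z) - (*v) (J xs)) = spectral_norm (J z - J xs)"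
        by (simp add: spectral_norm_def fun_diff_def matrix_vector_mult_diff_rdistrib)
      also have "\<dots> \<le> M * norm (z - xs)" by (rule lip)
      also have "\<dots> \<le> M * norm (y - xs)"
        using that M_nonneg by (intro mult_left_mono) (auto simp: dist_norm norm_minus_commute)
      finally show ?thesis .
    qed
  qed simp
  then show ?thesis by (simp add: root mult.commute)
qed

text \<open>
  Banach's perturbation argument: \<open>J(x*)\<close> stretches every vector by at least \<open>1/c\<close>, and the
  perturbation takes away at most a third of that, so \<open>A\<close> is injective with
  \<open>\<parallel>A\<^sup>-\<^sup>1\<parallel> \<le> 3 c / 2\<close>.
\<close>

lemma perturbed_inverse_bound:
  assumes "c * spectral_norm (A - J xs) \<le> 1 / 3"
  shows "norm v \<le> 3 / 2 * c * norm (A *v v)" and "invertible A"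
proof -
  have *: "norm w \<le> 3 / 2 * c * norm (A *v w)" for w
  proof -
    have "J xs *v w = A *v w - (A - J xs) *v w"
      by (simp add: matrix_vector_mult_diff_rdistrib)
    then have "norm (J xs *v w) \<le> norm (A *v w) + norm ((A - J xs) *v w)"
      by (metis norm_triangle_ineq4)
    also have "\<dots> \<le> norm (A *v w) + spectral_norm (A - J xs) * norm w"
      using norm_matrix_vector_le by (rule add_left_mono)
    finally have "norm (J xs *v w) \<le> \<dots>" .
    then have "c * norm (J xs *v w) \<le> c * (norm (A *v w) + spectral_norm (A - J xs) * norm w)"
      using c_pos by (intro mult_left_mono) auto
    also have "\<dots> = c * norm (A *v w) + (c * spectral_norm (A - J xs)) * norm w"
      by (simp add: algebra_simps)
    also have "\<dots> \<le> c * norm (A *v w) + 1 / 3 * norm w"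
      using assms by (intro add_left_mono mult_right_mono) auto
    finally show ?thesis
      using norm_le_inverse_bound[of w] by simp
  qed
  then show "norm v \<le> 3 / 2 * c * norm (A *v v)" .
  have "w = 0" if "A *v w = 0" for w
    using *[of w] that by simp
  then have "inj ((*v) A)"
    using linear_injective_0[OF matrix_vector_mul_linear, of A] by blast
  then show "invertible A"
    by (simp add: invertible_left_inverse matrix_left_invertible_injective)
qed

text \<open>
  With \<open>e = y - x*\<close>, the new error \<open>e'\<close> satisfies
  \<open>A e' = (A - J(x*)) e - (F(y) - J(x*) e)\<close>: a model error, linear in \<open>e\<close>, and a linearization
  error, quadratic in \<open>e\<close>. Then \<open>A\<close> is inverted.
\<close>

lemma quasi_newton_error:
  assumes "c * spectral_norm (A - J xs) \<le> 1 / 3"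
  shows "norm (y - matrix_inv A *v F y - xs)
    \<le> 3 / 2 * (c * spectral_norm (A - J xs) + c * M * norm (y - xs)) * norm (y - xs)"
proof -
  let ?e = "y - xs" and ?e' = "y - matrix_inv A *v F y - xs"
  have "A *v ?e' = A *v ?e - A *v (matrix_inv A *v F y)"
    by (simp add: matrix_vector_mult_diff_distrib algebra_simps)
  also have "\<dots> = (A - J xs) *v ?e - (F y - J xs *v ?e)"
    using perturbed_inverse_bound(2)[OF assms]
    by (simp add: matrix_inv_mult_right matrix_vector_mult_diff_rdistrib)
  finally have "norm (A *v ?e') \<le> norm ((A - J xs) *v ?e) + norm (F y - J xs *v ?e)"
    by (simp add: norm_triangle_ineq4)
  also have "\<dots> \<le> spectral_norm (A - J xs) * norm ?e + M * norm ?e * norm ?e"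
    by (intro add_mono norm_matrix_vector_le linearization_error)
  finally have "3 / 2 * c * norm (A *v ?e')
      \<le> 3 / 2 * c * (spectral_norm (A - J xs) * norm ?e + M * norm ?e * norm ?e)"
    using c_pos by (intro mult_left_mono) auto
  with perturbed_inverse_bound(1)[OF assms, of ?e'] show ?thesis
    by (simp add: algebra_simps)
qed

end

section \<open>Replacing one column\<close>

text \<open>
  For a unit vector \<open>b\<close> this is the matrix that acts like \<open>E\<close> on \<open>b\<close> and like \<open>D\<close> on the orthogonal
  complement of \<open>b\<close>. The error matrices \<open>B\<^sub>k - J(x*)\<close> evolve by this operation, with
  \<open>E = J(x\<^sub>k\<^sub>+\<^sub>1) - J(x*)\<close>.
\<close>

definition replace_along :: "real ^ 'n ^ 'n \<Rightarrow> real ^ 'n ^ 'n \<Rightarrow> real ^ 'n \<Rightarrow> real ^ 'n ^ 'n" where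
  "replace_along D E b = D + outer_product (E *v b - D *v b) b"

lemma replace_along_mult: "replace_along D E b *v v = D *v (v - (b \<bullet> v) *\<^sub>R b) + (b \<bullet> v) *\<^sub>R (E *v b)"
  by (simp add: replace_along_def matrix_vector_mult_add_rdistrib outer_product_vector_mult
      matrix_vector_mult_diff_distrib matrix_vector_mult_scaleR algebra_simps)

text \<open>
  \<open>D\<close> is composed with an orthogonal projection and \<open>E\<close> with the complementary one, and neither
  projection increases a spectral norm.
\<close>

lemma spectral_norm_replace_along:
  assumes "norm b = 1"
  shows "spectral_norm (replace_along D E b) \<le> spectral_norm D + spectral_norm E"
proof (rule spectral_norm_leI)
  fix v
  let ?p = "(b \<bullet> v) *\<^sub>R b"
  have bb: "b \<bullet> b = 1" using assms by (simp add: norm_eq_1)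
  have pythagoras: "(norm v)\<^sup>2 = (norm (v - ?p))\<^sup>2 + (b \<bullet> v)\<^sup>2"
    unfolding power2_norm_eq_inner inner_diff_left inner_diff_right inner_scaleR_left
      inner_scaleR_right bb inner_commute[of v b]
    by algebra
  have proj: "norm (v - ?p) \<le> norm v"
    by (rule power2_le_imp_le[OF _ norm_ge_zero]) (simp only: pythagoras le_add_same_cancel1 zero_le_power2)
  have coef: "\<bar>b \<bullet> v\<bar> \<le> norm v"
    using Cauchy_Schwarz_ineq2[of b v] assms by simp
  have "norm (replace_along D E b *v v) \<le> norm (D *v (v - ?p)) + \<bar>b \<bullet> v\<bar> * norm (E *v b)"
    unfolding replace_along_mult by (rule order_trans[OF norm_triangle_ineq]) simp
  also have "\<dots> \<le> spectral_norm D * norm v + norm v * spectral_norm E"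
  proof (intro add_mono mult_mono coef)
    show "norm (D *v (v - ?p)) \<le> spectral_norm D * norm v"
      by (rule order_trans[OF norm_matrix_vector_le mult_left_mono[OF proj spectral_norm_nonneg]])
    show "norm (E *v b) \<le> spectral_norm E"
      using norm_matrix_vector_le[of E b] assms by simp
  qed auto
  finally show "norm (replace_along D E b *v v) \<le> (spectral_norm D + spectral_norm E) * norm v"
    by (simp add: algebra_simps)
qed

lemma norm_sq_replace_along:
  assumes b: "b \<in> Basis"
  shows "(norm (replace_along D E b))\<^sup>2 = (norm D)\<^sup>2 - (norm (D *v b))\<^sup>2 + (norm (E *v b))\<^sup>2"
proof -
  have "replace_along D E b *v b' = D *v b'" if "b' \<in> Basis - {b}" for b'
    using that b by (auto simp: replace_along_mult inner_Basis)
  moreover have "replace_along D E b *v b = E *v b"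
    using b by (simp add: replace_along_mult)
  ultimately show ?thesis
    using b by (simp add: norm_matrix_sq_eq_sum_Basis sum.remove[OF finite_Basis b])
qed

section \<open>The method as a recursion driven by its directions\<close>

definition broyden_step ::
  "(real ^ 'n \<Rightarrow> real ^ 'n) \<Rightarrow> (real ^ 'n \<Rightarrow> real ^ 'n ^ 'n) \<Rightarrow>
   (real ^ 'n) \<times> (real ^ 'n ^ 'n) \<Rightarrow> real ^ 'n \<Rightarrow> (real ^ 'n) \<times> (real ^ 'n ^ 'n)" where
  "broyden_step F J z b =
    (let y = fst z - matrix_inv (snd z) *v F (fst z)
     in (y, snd z + (1 / (b \<bullet> b)) *\<^sub>R outer_product (J y *v b - snd z *v b) b))"

lemma broyden_iterates_step:
  assumes "broyden_iterates F J x0 B0 u x B"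
  shows "(x 0, B 0) = (x0, B0)"
    and "(x (Suc k), B (Suc k)) = broyden_step F J (x k, B k) (u k)"
  using assms by (simp_all add: broyden_iterates_def broyden_step_def Let_def)

context lipschitz_root
begin

text \<open>
  The region in which the method is stable. The factor \<open>2\<close> is the sum of \<open>1 + 1/2 + 1/4 + \<dots>\<close>: the
  residual term \<open>c M \<parallel>x - x*\<parallel>\<close> is halved in every step, so twice its current value bounds
  everything that the matrix error can still gain.
\<close>

definition safe :: "(real ^ 'n) \<times> (real ^ 'n ^ 'n) \<Rightarrow> bool" where
  "safe z \<longleftrightarrow> c * spectral_norm (snd z - J xs) + 2 * (c * M * norm (fst z - xs)) \<le> 1 / 3"

definition potential :: "(real ^ 'n) \<times> (real ^ 'n ^ 'n) \<Rightarrow> real" where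
  "potential z = (c * norm (snd z - J xs))\<^sup>2 + (c * M * norm (fst z - xs))\<^sup>2"

lemma potential_nonneg: "0 \<le> potential z"
  by (simp add: potential_def)

lemma scaled_nonneg: "0 \<le> c * spectral_norm A" "0 \<le> c * M * norm v"
  using c_pos M_nonneg spectral_norm_nonneg[of A] by auto

lemma broyden_step_matrix_error:
  assumes "b \<in> Basis"
  shows "snd (broyden_step F J z b) - J xs
    = replace_along (snd z - J xs) (J (fst (broyden_step F J z b)) - J xs) b"
  using assms by (simp add: broyden_step_def Let_def replace_along_def matrix_vector_mult_diff_rdistrib)

lemma norm_broyden_step_le_product:
  assumes "safe z"
  shows "norm (fst (broyden_step F J z b) - xs)
    \<le> 3 / 2 * (c * spectral_norm (snd z - J xs) + c * M * norm (fst z - xs)) * norm (fst z - xs)"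
proof -
  have "c * spectral_norm (snd z - J xs) \<le> 1 / 3"
    using assms scaled_nonneg(2)[of "fst z - xs"] by (simp add: safe_def)
  from quasi_newton_error[OF this] show ?thesis
    by (simp add: broyden_step_def Let_def)
qed

lemma norm_broyden_step_le_half:
  assumes "safe z"
  shows "norm (fst (broyden_step F J z b) - xs) \<le> norm (fst z - xs) / 2"
proof -
  have "3 / 2 * (c * spectral_norm (snd z - J xs) + c * M * norm (fst z - xs)) \<le> 1 / 2"
    using assms scaled_nonneg(2)[of "fst z - xs"] by (simp add: safe_def)
  from order_trans[OF norm_broyden_step_le_product[OF assms] mult_right_mono[OF this]]
  show ?thesis by simp
qed

lemma residual_broyden_step_le_half:
  assumes "safe z"
  shows "c * M * norm (fst (broyden_step F J z b) - xs) \<le> c * M * norm (fst z - xs) / 2"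
  using mult_left_mono[OF norm_broyden_step_le_half[OF assms], of "c * M"] c_pos M_nonneg by simp

lemma safe_broyden_step:
  assumes z: "safe z" and b: "b \<in> Basis"
  shows "safe (broyden_step F J z b)"
proof -
  let ?z' = "broyden_step F J z b"
  have "spectral_norm (snd ?z' - J xs)
      \<le> spectral_norm (snd z - J xs) + spectral_norm (J (fst ?z') - J xs)"
    unfolding broyden_step_matrix_error[OF b] using b by (intro spectral_norm_replace_along) simp
  also have "\<dots> \<le> spectral_norm (snd z - J xs) + M * norm (fst ?z' - xs)"
    by (intro add_left_mono lip)
  finally have "c * spectral_norm (snd ?z' - J xs)
      \<le> c * spectral_norm (snd z - J xs) + c * M * norm (fst ?z' - xs)"
    using c_pos mult_left_mono[of _ _ c] by (fastforce simp: distrib_left)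
  with residual_broyden_step_le_half[OF z, of b] scaled_nonneg(2)[of "fst z - xs"] z
  show ?thesis unfolding safe_def by linarith
qed

text \<open>
  The new column of the matrix error contributes at most \<open>\<rho>'\<^sup>2\<close>, where \<open>\<rho>'\<close> is the new residual
  term, and the residual part of the potential is also \<open>\<rho>'\<^sup>2\<close>. As \<open>\<rho>' \<le> \<rho>/2\<close>, both together
  amount to at most half of the old \<open>\<rho>\<^sup>2\<close>.
\<close>

lemma potential_broyden_step:
  assumes z: "safe z" and b: "b \<in> Basis"
  shows "potential (broyden_step F J z b)
    \<le> potential z - (c * M * norm (fst z - xs))\<^sup>2 / 2 - c\<^sup>2 * (norm ((snd z - J xs) *v b))\<^sup>2"
proof -
  let ?z' = "broyden_step F J z b"
  let ?r = "c * M * norm (fst z - xs)" and ?r' = "c * M * norm (fst ?z' - xs)"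
  let ?D = "snd z - J xs" and ?E = "J (fst ?z') - J xs"
  have "norm (?E *v b) \<le> M * norm (fst ?z' - xs)"
    using norm_matrix_vector_le[of ?E b] lip[of "fst ?z'"] b by simp
  then have "c * norm (?E *v b) \<le> ?r'"
    using c_pos by (simp add: mult.assoc)
  then have "(c * norm (?E *v b))\<^sup>2 \<le> ?r'\<^sup>2"
    using c_pos by (intro power_mono) auto
  then have col: "c\<^sup>2 * (norm (?E *v b))\<^sup>2 \<le> ?r'\<^sup>2"
    by (simp add: power_mult_distrib)
  have "?r'\<^sup>2 \<le> (?r / 2)\<^sup>2"
    by (intro power_mono residual_broyden_step_le_half[OF z] scaled_nonneg)
  then have half: "?r'\<^sup>2 \<le> ?r\<^sup>2 / 4"
    by (simp add: power_divide)
  have "potential ?z' = c\<^sup>2 * (norm (snd ?z' - J xs))\<^sup>2 + ?r'\<^sup>2"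
    unfolding potential_def by (simp only: power_mult_distrib)
  also have "\<dots> = c\<^sup>2 * (norm ?D)\<^sup>2 - c\<^sup>2 * (norm (?D *v b))\<^sup>2 + c\<^sup>2 * (norm (?E *v b))\<^sup>2 + ?r'\<^sup>2"
    unfolding broyden_step_matrix_error[OF b] norm_sq_replace_along[OF b] by (simp add: algebra_simps)
  also have "\<dots> \<le> c\<^sup>2 * (norm ?D)\<^sup>2 - c\<^sup>2 * (norm (?D *v b))\<^sup>2 + ?r\<^sup>2 / 2"
    using col half by linarith
  also have "\<dots> = potential z - ?r\<^sup>2 / 2 - c\<^sup>2 * (norm (?D *v b))\<^sup>2"
    unfolding potential_def by (simp add: power_mult_distrib)
  finally show ?thesis .
qed

text \<open>
  The squared column norms add up to the squared Frobenius norm, so the matrix part of the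
  potential loses one of its \<open>n\<close> copies. The residual part loses at least \<open>n/2\<close> of its \<open>n\<close> copies,
  which for \<open>n \<ge> 2\<close> is at least as much.
\<close>

lemma sum_potential_broyden_step:
  assumes z: "safe z" and n: "2 \<le> CARD('n)"
  shows "(\<Sum>b\<in>Basis. potential (broyden_step F J z b)) \<le> (CARD('n) - 1) * potential z"
proof -
  let ?D = "snd z - J xs" and ?r = "c * M * norm (fst z - xs)" and ?n = "real CARD('n)"
  have "(\<Sum>b\<in>Basis. potential (broyden_step F J z b))
      \<le> (\<Sum>b\<in>Basis. potential z - ?r\<^sup>2 / 2 - c\<^sup>2 * (norm (?D *v b))\<^sup>2)"
    by (intro sum_mono potential_broyden_step z)
  also have "\<dots> = ?n * (potential z - ?r\<^sup>2 / 2) - c\<^sup>2 * (norm ?D)\<^sup>2"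
    by (simp add: sum_subtractf norm_matrix_sq_eq_sum_Basis sum_distrib_left)
  also have "\<dots> = ?n * potential z - ?n * (?r\<^sup>2 / 2) - c\<^sup>2 * (norm ?D)\<^sup>2"
    by (simp add: algebra_simps)
  also have "\<dots> \<le> ?n * potential z - ?r\<^sup>2 - c\<^sup>2 * (norm ?D)\<^sup>2"
    using n mult_right_mono[of 2 ?n "?r\<^sup>2 / 2"] by simp
  also have "\<dots> = (?n - 1) * potential z"
    unfolding potential_def by (simp add: power_mult_distrib algebra_simps)
  finally show ?thesis
    using n by (simp add: of_nat_diff)
qed

lemma broyden_iterates_safe:
  assumes it: "broyden_iterates F J x0 B0 u x B" and u: "\<And>k. u k \<in> Basis" and "safe (x0, B0)"
  shows "safe (x k, B k)"
proof (induction k)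
  case 0
  show ?case using assms(3) by (simp add: broyden_iterates_step(1)[OF it])
next
  case (Suc k)
  then show ?case by (simp add: broyden_iterates_step(2)[OF it] safe_broyden_step u)
qed

lemma sum_errors_le_sqrt_potential:
  "c * spectral_norm (snd z - J xs) + c * M * norm (fst z - xs) \<le> 2 * sqrt (potential z)"
proof -
  have "c * spectral_norm (snd z - J xs) \<le> c * norm (snd z - J xs)"
    using c_pos spectral_norm_le_norm by simp
  also have "\<dots> \<le> sqrt (potential z)"
    by (rule real_le_rsqrt) (simp add: potential_def)
  finally have "c * spectral_norm (snd z - J xs) \<le> sqrt (potential z)" .
  moreover have "c * M * norm (fst z - xs) \<le> sqrt (potential z)"
    by (rule real_le_rsqrt) (simp add: potential_def)
  ultimately show ?thesis by simp
qed

lemma sq_powr_half: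
  assumes "0 < (q::real)"
  shows "(a * q powr (real k / 2))\<^sup>2 = a\<^sup>2 * q ^ k"
proof -
  have "(q powr (real k / 2))\<^sup>2 = q powr (real k / 2 + real k / 2)"
    by (simp only: power2_eq_square powr_add)
  also have "\<dots> = q ^ k" using assms by (simp add: powr_realpow)
  finally show ?thesis by (simp only: power_mult_distrib)
qed

text \<open>
  By \<open>norm_broyden_step_le_product\<close> and \<open>sum_errors_le_sqrt_potential\<close>, the decay of the potential
  makes the contraction factor of step \<open>k\<close> at most \<open>3/2 \<cdot> 2 a q\<^sup>k\<^sup>/\<^sup>2\<close>. The bound is the product of
  these factors.
\<close>

lemma iterate_bound_of_potential:
  assumes it: "broyden_iterates F J x0 B0 u x B" and safe: "\<And>k. safe (x k, B k)"
    and q: "0 < q" and a: "0 \<le> a"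
    and pot: "\<And>k. potential (x k, B k) \<le> a\<^sup>2 * q ^ k"
  shows "norm (x k - xs) \<le> (3 * a) ^ k * q powr (real k * (real k - 1) / 4) * norm (x0 - xs)"
proof (induction k)
  case 0
  show ?case using it q by (simp add: broyden_iterates_def)
next
  case (Suc k)
  have "sqrt (potential (x k, B k)) \<le> a * q powr (real k / 2)"
  proof (rule real_le_lsqrt)
    show "potential (x k, B k) \<le> (a * q powr (real k / 2))\<^sup>2"
      using pot[of k] by (simp only: sq_powr_half[OF q])
  qed (use q a in auto)
  with sum_errors_le_sqrt_potential[of "(x k, B k)"]
  have *: "3 / 2 * (c * spectral_norm (B k - J xs) + c * M * norm (x k - xs))
      \<le> 3 * a * q powr (real k / 2)" by simp
  have "norm (x (Suc k) - xs)
      \<le> 3 / 2 * (c * spectral_norm (B k - J xs) + c * M * norm (x k - xs)) * norm (x k - xs)"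
    using norm_broyden_step_le_product[OF safe, of k "u k"]
    by (simp flip: broyden_iterates_step(2)[OF it])
  also have "\<dots> \<le> (3 * a * q powr (real k / 2)) * norm (x k - xs)"
    by (intro mult_right_mono *) simp
  also have "\<dots> \<le> (3 * a * q powr (real k / 2)) *
      ((3 * a) ^ k * q powr (real k * (real k - 1) / 4) * norm (x0 - xs))"
    using a by (intro mult_left_mono Suc.IH) auto
  also have "\<dots> = (3 * a) ^ Suc k * (q powr (real k / 2) * q powr (real k * (real k - 1) / 4))
      * norm (x0 - xs)"
    by simp
  also have "q powr (real k / 2) * q powr (real k * (real k - 1) / 4)
      = q powr (real (Suc k) * (real (Suc k) - 1) / 4)"
    by (simp add: powr_add[symmetric] field_simps)
  finally show ?case .
qed

lemma matrix_bound_of_potential: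
  assumes "0 < q" and "0 \<le> a" and pot: "potential (y, A) \<le> a\<^sup>2 * q ^ k"
  shows "norm (A - J xs) \<le> a / c * q powr (real k / 2)"
proof -
  have "(c * norm (A - J xs))\<^sup>2 \<le> potential (y, A)"
    by (simp add: potential_def)
  also have "\<dots> \<le> (a * q powr (real k / 2))\<^sup>2"
    using pot by (simp only: sq_powr_half[OF assms(1)])
  finally have "c * norm (A - J xs) \<le> a * q powr (real k / 2)"
    by (rule power2_le_imp_le) (use assms in auto)
  then show ?thesis using c_pos by (simp add: field_simps)
qed

text \<open>
  The hypothesis controls the distance of \<open>B\<^sub>0\<close> to \<open>J(x\<^sub>0)\<close>; passing to \<open>J(x*)\<close> costs one term
  \<open>\<rho>\<^sub>0\<close> and stability another two, all covered by the multiple of \<open>\<rho>\<^sub>0\<close> in the hypothesis.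
\<close>

lemma initial_errors:
  assumes "48 * sqrt (real CARD('n)) * c * M * norm (x0 - xs) + c * spectral_norm (B0 - J x0) \<le> 1 / 3"
  shows "safe (x0, B0)" and "potential (x0, B0) \<le> CARD('n)"
proof -
  let ?r = "c * M * norm (x0 - xs)" and ?s = "c * spectral_norm (B0 - J xs)"
    and ?n = "real CARD('n)"
  have n: "1 \<le> ?n" by (simp add: Suc_leI)
  have "48 * sqrt ?n * ?r \<ge> 3 * ?r"
  proof (intro mult_right_mono scaled_nonneg(2))
    have "1 \<le> sqrt ?n" using n by simp
    then show "3 \<le> 48 * sqrt ?n" by linarith
  qed
  moreover have "spectral_norm (B0 - J xs) \<le> spectral_norm (B0 - J x0) + M * norm (x0 - xs)"
    using spectral_norm_triangle[of "B0 - J x0" "J x0 - J xs"] lip[of x0] by simp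
  then have "?s \<le> c * spectral_norm (B0 - J x0) + ?r"
    using c_pos mult_left_mono[of _ _ c] by (fastforce simp: distrib_left)
  moreover have "48 * sqrt ?n * ?r + c * spectral_norm (B0 - J x0) \<le> 1 / 3"
    using assms by (simp add: mult.assoc)
  ultimately have *: "?s + 2 * ?r \<le> 1 / 3"
    by linarith
  then show "safe (x0, B0)" by (simp add: safe_def)
  have "?s \<le> 1 / 3" "?r \<le> 1 / 3"
    using * scaled_nonneg(1)[of "B0 - J xs"] scaled_nonneg(2)[of "x0 - xs"] by linarith+
  then have "?s\<^sup>2 \<le> (1 / 3)\<^sup>2" "?r\<^sup>2 \<le> (1 / 3)\<^sup>2"
    by (intro power_mono scaled_nonneg; simp)+
  then have sq: "?s\<^sup>2 \<le> 1 / 9" "?r\<^sup>2 \<le> 1 / 9"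
    by (simp_all only: power_divide) simp_all
  have "(c * norm (B0 - J xs))\<^sup>2 \<le> ?n * ?s\<^sup>2"
    using mult_left_mono[OF norm_sq_le_card_spectral_norm_sq[of "B0 - J xs"], of "c\<^sup>2"]
    by (simp add: power_mult_distrib algebra_simps)
  also have "\<dots> \<le> ?n * (1 / 9)"
    using sq(1) by (intro mult_left_mono) auto
  finally show "potential (x0, B0) \<le> ?n"
    using sq(2) n unfolding potential_def fst_conv snd_conv by linarith
qed

end

section \<open>Recursions driven by independent uniform draws\<close>

text \<open>
  The probabilistic part uses only that the state evolves deterministically from independent
  uniform draws out of a finite set. The state space carries no \<open>\<sigma>\<close>-algebra: after \<open>k\<close>
  steps the state is a function of a finite history, and every real function of it is measurable
  and bounded. This avoids any question about the measurability of the matrix inverse.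
\<close>

locale uniform_recursion = prob_space P for P :: "'w measure" +
  fixes S :: "'e set" and u :: "nat \<Rightarrow> 'w \<Rightarrow> 'e" and Z :: "nat \<Rightarrow> 'w \<Rightarrow> 's"
    and z0 :: 's and step :: "'s \<Rightarrow> 'e \<Rightarrow> 's"
  assumes finite_S: "finite S"
    and indep: "indep_vars (\<lambda>_. count_space S) u UNIV"
    and uniform: "\<And>k. distr P (count_space S) (u k) = uniform_count_measure S"
    and Z_0: "\<And>\<omega>. \<omega> \<in> space P \<Longrightarrow> Z 0 \<omega> = z0"
    and Z_Suc: "\<And>k \<omega>. \<omega> \<in> space P \<Longrightarrow> Z (Suc k) \<omega> = step (Z k \<omega>) (u k \<omega>)"
begin

lemma measurable_draw: "u k \<in> measurable P (count_space S)"
  using indep by (simp add: indep_vars_def)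

lemma draw_in: "\<omega> \<in> space P \<Longrightarrow> u k \<omega> \<in> S"
  using measurable_space[OF measurable_draw] by simp

abbreviation history :: "nat \<Rightarrow> 'w \<Rightarrow> nat \<Rightarrow> 'e" where
  "history k \<omega> \<equiv> restrict (\<lambda>i. u i \<omega>) {..<k}"

lemma PiM_history: "PiM {..<k :: nat} (\<lambda>_. count_space S) = count_space ({..<k} \<rightarrow>\<^sub>E S)"
  by (rule count_space_PiM_finite) (simp_all add: finite_S countable_finite)

lemma measurable_history: "history k \<in> measurable P (count_space ({..<k} \<rightarrow>\<^sub>E S))"
  unfolding PiM_history[symmetric] by (intro measurable_restrict measurable_draw)

lemma state_from_history: "\<exists>g. \<forall>\<omega>\<in>space P. Z k \<omega> = g (history k \<omega>)"
proof (induction k)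
  case 0
  show ?case using Z_0 by auto
next
  case (Suc k)
  then obtain g where g: "\<forall>\<omega>\<in>space P. Z k \<omega> = g (history k \<omega>)" by blast
  have "history k \<omega> = restrict (history (Suc k) \<omega>) {..<k}" for \<omega>
    by (auto simp: restrict_def)
  then have "\<forall>\<omega>\<in>space P. Z (Suc k) \<omega> =
      (\<lambda>h. step (g (restrict h {..<k})) (h k)) (history (Suc k) \<omega>)"
    using g by (simp add: Z_Suc)
  then show ?case by (rule exI[where P = "\<lambda>g. \<forall>\<omega>\<in>space P. Z (Suc k) \<omega> = g (history (Suc k) \<omega>)"])
qed

lemma borel_measurable_state: "(\<lambda>\<omega>. (f (Z k \<omega>) :: real)) \<in> borel_measurable P"
proof -
  obtain g where g: "\<forall>\<omega>\<in>space P. Z k \<omega> = g (history k \<omega>)"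
    using state_from_history by blast
  have "(\<lambda>\<omega>. f (g (history k \<omega>))) \<in> borel_measurable P"
    by (rule measurable_compose[OF measurable_history]) simp
  then show ?thesis using g by (simp cong: measurable_cong)
qed

lemma integrable_state: "integrable P (\<lambda>\<omega>. f (Z k \<omega>) :: real)"
proof -
  obtain g where g: "\<forall>\<omega>\<in>space P. Z k \<omega> = g (history k \<omega>)"
    using state_from_history by blast
  let ?H = "{..<k} \<rightarrow>\<^sub>E S"
  have "norm (f (Z k \<omega>)) \<le> (\<Sum>h\<in>?H. \<bar>f (g h)\<bar>)" if "\<omega> \<in> space P" for \<omega>
  proof -
    have "history k \<omega> \<in> ?H" using draw_in[OF that] by auto
    then have "\<bar>f (g (history k \<omega>))\<bar> \<le> (\<Sum>h\<in>?H. \<bar>f (g h)\<bar>)"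
      by (intro member_le_sum[where f = "\<lambda>h. \<bar>f (g h)\<bar>"]) (auto intro!: finite_PiE finite_S)
    then show ?thesis using g that by simp
  qed
  then show ?thesis
    by (intro integrable_const_bound[where B = "\<Sum>h\<in>?H. \<bar>f (g h)\<bar>"] borel_measurable_state) auto
qed

lemma prob_draw:
  assumes "b \<in> S"
  shows "expectation (\<lambda>\<omega>. indicator {b} (u k \<omega>)) = 1 / card S"
proof -
  have "expectation (\<lambda>\<omega>. indicator {b} (u k \<omega>) :: real)
      = (\<integral>e. indicator {b} e \<partial>(distr P (count_space S) (u k)))"
    by (rule integral_distr[OF measurable_draw, symmetric]) simp
  also have "\<dots> = measure (uniform_count_measure S) {b}"
    using assms unfolding uniform by (simp add: space_uniform_count_measure Int_absorb2 Int_absorb1)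
  also have "\<dots> = 1 / card S"
    using assms finite_S by (simp add: measure_uniform_count_measure)
  finally show ?thesis .
qed

text \<open>
  The state is a function of the draws before time \<open>k\<close>, hence independent of draw \<open>k\<close>. This is the
  tower property for a conditional expectation given the history, in the elementary form
  available for finitely many values: split according to the value of the draw and
  factorize each summand.
\<close>

lemma expectation_step:
  fixes f :: "'s \<Rightarrow> real"
  shows "expectation (\<lambda>\<omega>. f (Z (Suc k) \<omega>))
    = expectation (\<lambda>\<omega>. (\<Sum>b\<in>S. f (step (Z k \<omega>) b)) / card S)"
proof -
  obtain g where g: "\<forall>\<omega>\<in>space P. Z k \<omega> = g (history k \<omega>)"
    using state_from_history by blast
  have pre: "indep_var (PiM {..<k} (\<lambda>_. count_space S)) (history k)
      (PiM {k} (\<lambda>_. count_space S)) (\<lambda>\<omega>. restrict (\<lambda>i. u i \<omega>) {k})"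
    by (rule indep_var_restrict[OF indep]) auto
  \<comment> \<open>Independence needs the state as a function of the history everywhere, not only on the
      sample space.\<close>
  define Y where "Y b \<omega> = f (step (g (history k \<omega>)) b)" for b \<omega>
  have Y: "Y b \<omega> = f (step (Z k \<omega>) b)" if "\<omega> \<in> space P" for b \<omega>
    using g that by (simp add: Y_def)
  have int_Y: "integrable P (Y b)" for b
    using integrable_state[of "\<lambda>z. f (step z b)" k] Y
    by (simp cong: Bochner_Integration.integrable_cong)
  have ind: "indep_var borel (Y b) borel (\<lambda>\<omega>. indicator {b} (u k \<omega>) :: real)" for b
  proof -
    have "indep_var borel ((\<lambda>h. f (step (g h) b)) \<circ> history k)
        borel ((\<lambda>h. indicator {b} (h k) :: real) \<circ> (\<lambda>\<omega>. restrict (\<lambda>i. u i \<omega>) {k}))"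
    proof (rule indep_var_compose[OF pre])
      show "(\<lambda>h. f (step (g h) b)) \<in> borel_measurable (PiM {..<k} (\<lambda>_. count_space S))"
        unfolding PiM_history by simp
      show "(\<lambda>h. indicator {b} (h k) :: real) \<in> borel_measurable (PiM {k} (\<lambda>_. count_space S))"
        by (rule measurable_compose[OF measurable_component_singleton[where i = k]]) auto
    qed
    then show ?thesis
      by (simp add: comp_def Y_def[abs_def])
  qed
  have int_ind: "integrable P (\<lambda>\<omega>. indicator {b} (u k \<omega>) :: real)" for b
    by (rule integrable_const_bound[where B = 1])
      (auto intro!: measurable_compose[OF measurable_draw] simp: indicator_def)
  have "expectation (\<lambda>\<omega>. f (Z (Suc k) \<omega>))
      = expectation (\<lambda>\<omega>. \<Sum>b\<in>S. Y b \<omega> * indicator {b} (u k \<omega>))"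
  proof (rule Bochner_Integration.integral_cong[OF refl])
    fix \<omega> assume w: "\<omega> \<in> space P"
    have "(\<Sum>b\<in>S. Y b \<omega> * indicator {b} (u k \<omega>))
        = (\<Sum>b\<in>S. if b = u k \<omega> then Y b \<omega> else 0)"
      by (intro sum.cong) (auto simp: indicator_def)
    also have "\<dots> = f (Z (Suc k) \<omega>)"
      using finite_S draw_in[OF w] by (simp add: Z_Suc Y w)
    finally show "f (Z (Suc k) \<omega>) = (\<Sum>b\<in>S. Y b \<omega> * indicator {b} (u k \<omega>))" ..
  qed
  also have "\<dots> = (\<Sum>b\<in>S. expectation (\<lambda>\<omega>. Y b \<omega> * indicator {b} (u k \<omega>)))"
    by (intro Bochner_Integration.integral_sum indep_var_integrable ind int_Y int_ind)
  also have "\<dots> = (\<Sum>b\<in>S. expectation (\<lambda>\<omega>. Y b \<omega>) * (1 / card S))"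
    by (intro sum.cong refl)
      (simp add: indep_var_lebesgue_integral[OF ind int_Y int_ind] prob_draw)
  also have "\<dots> = expectation (\<lambda>\<omega>. (\<Sum>b\<in>S. Y b \<omega>) / card S)"
    by (simp add: sum_divide_distrib Bochner_Integration.integral_sum int_Y)
  also have "\<dots> = expectation (\<lambda>\<omega>. (\<Sum>b\<in>S. f (step (Z k \<omega>) b)) / card S)"
    by (intro Bochner_Integration.integral_cong) (simp_all add: Y)
  finally show ?thesis .
qed

lemma expectation_geometric:
  fixes f :: "'s \<Rightarrow> real" and q :: real
  assumes drift: "\<And>k \<omega>. \<omega> \<in> space P \<Longrightarrow> (\<Sum>b\<in>S. f (step (Z k \<omega>) b)) \<le> card S * q * f (Z k \<omega>)"
    and q: "0 \<le> q" and S: "S \<noteq> {}"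
  shows "expectation (\<lambda>\<omega>. f (Z k \<omega>)) \<le> q ^ k * f z0"
proof (induction k)
  case 0
  have "expectation (\<lambda>\<omega>. f (Z 0 \<omega>)) = expectation (\<lambda>_. f z0)"
    by (intro Bochner_Integration.integral_cong) (auto simp: Z_0)
  then show ?case by (simp add: prob_space)
next
  case (Suc k)
  have "expectation (\<lambda>\<omega>. f (Z (Suc k) \<omega>)) \<le> expectation (\<lambda>\<omega>. q * f (Z k \<omega>))"
    unfolding expectation_step
  proof (rule integral_mono)
    show "integrable P (\<lambda>\<omega>. (\<Sum>b\<in>S. f (step (Z k \<omega>) b)) / card S)"
      by (rule integrable_state)
    show "integrable P (\<lambda>\<omega>. q * f (Z k \<omega>))"
      by (rule integrable_state)
    show "(\<Sum>b\<in>S. f (step (Z k \<omega>) b)) / card S \<le> q * f (Z k \<omega>)" if "\<omega> \<in> space P" for \<omega>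
      using drift[OF that, of k] S finite_S by (simp add: field_simps card_gt_0_iff)
  qed
  also have "\<dots> \<le> q * (q ^ k * f z0)"
    using Suc q by (simp add: mult_left_mono)
  finally show ?case by (simp add: mult.assoc)
qed

text \<open>
  Markov's inequality at level \<open>a Q\<^sup>k\<close> bounds the probability of the excess at time \<open>k\<close> by
  \<open>f z\<^sub>0 / a \<cdot> (q/Q)\<^sup>k\<close>. Giving up a little of the rate, \<open>Q\<close> instead of \<open>q\<close>, makes these
  probabilities summable and so controls all times simultaneously.
\<close>

lemma prob_exceed_geometric:
  fixes f :: "'s \<Rightarrow> real" and a q Q :: real
  assumes drift: "\<And>k \<omega>. \<omega> \<in> space P \<Longrightarrow> (\<Sum>b\<in>S. f (step (Z k \<omega>) b)) \<le> card S * q * f (Z k \<omega>)"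
    and S: "S \<noteq> {}" and f: "\<And>z. 0 \<le> f z" and q: "0 \<le> q" "q < Q" and a: "0 < a"
  shows "{\<omega> \<in> space P. \<exists>k. a * Q ^ k \<le> f (Z k \<omega>)} \<in> events"
    and "prob {\<omega> \<in> space P. \<exists>k. a * Q ^ k \<le> f (Z k \<omega>)} \<le> f z0 / (a * (1 - q / Q))"
proof -
  define A where "A k = {\<omega> \<in> space P. a * Q ^ k \<le> f (Z k \<omega>)}" for k
  have Q: "0 < Q" using q by simp
  have A: "A k \<in> events" for k
    unfolding A_def using borel_measurable_state[of f k] by measurable
  have eq: "{\<omega> \<in> space P. \<exists>k. a * Q ^ k \<le> f (Z k \<omega>)} = (\<Union>k. A k)"
    by (auto simp: A_def)
  show "{\<omega> \<in> space P. \<exists>k. a * Q ^ k \<le> f (Z k \<omega>)} \<in> events"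
    unfolding eq using A by auto
  have pA: "prob (A k) \<le> f z0 / a * (q / Q) ^ k" for k
  proof -
    have "prob (A k) \<le> expectation (\<lambda>\<omega>. f (Z k \<omega>)) / (a * Q ^ k)"
      unfolding A_def
      by (rule integral_Markov_inequality_measure[where A = "{}"]) (use f a Q integrable_state in auto)
    also have "\<dots> \<le> q ^ k * f z0 / (a * Q ^ k)"
      using a Q by (intro divide_right_mono expectation_geometric drift q S) auto
    finally show ?thesis by (simp add: power_divide mult.commute)
  qed
  have "(\<lambda>k. (q / Q) ^ k) sums (1 / (1 - q / Q))"
    using q Q by (intro geometric_sums) simp
  then have geo: "(\<lambda>k. f z0 / a * (q / Q) ^ k) sums (f z0 / a * (1 / (1 - q / Q)))"
    by (rule sums_mult)
  have summ: "summable (\<lambda>k. prob (A k))"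
    using pA by (intro summable_comparison_test[OF _ sums_summable[OF geo]]) auto
  have "prob (\<Union>k. A k) \<le> (\<Sum>k. prob (A k))"
    using A summ by (intro finite_measure_subadditive_countably) auto
  also have "\<dots> \<le> (\<Sum>k. f z0 / a * (q / Q) ^ k)"
    by (intro suminf_le pA summ sums_summable[OF geo])
  also have "\<dots> = f z0 / (a * (1 - q / Q))"
    using sums_unique[OF geo] by simp
  finally show "prob {\<omega> \<in> space P. \<exists>k. a * Q ^ k \<le> f (Z k \<omega>)} \<le> f z0 / (a * (1 - q / Q))"
    unfolding eq .
qed

end

section \<open>Convergence with high probability\<close>

theorem theorem4p5:
  fixes F :: "real ^ 'n \<Rightarrow> real ^ 'n"
    and J :: "real ^ 'n \<Rightarrow> real ^ 'n ^ 'n"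
    and xs x0 :: "real ^ 'n"
    and B0 :: "real ^ 'n ^ 'n"
    and M c \<delta> n :: real
    and P :: "'w measure"
    and u x :: "nat \<Rightarrow> 'w \<Rightarrow> real ^ 'n"
    and B :: "nat \<Rightarrow> 'w \<Rightarrow> real ^ 'n ^ 'n"
  defines "n \<equiv> real CARD('n)"
    and "c \<equiv> spectral_norm (matrix_inv (J xs))"
  assumes "CARD('n) \<ge> 2"
    and "\<And>y. (F has_derivative (\<lambda>h. J y *v h)) (at y)"
    and "F xs = 0"
    and "M \<ge> 0"
    and "\<And>y. spectral_norm (J y - J xs) \<le> M * norm (y - xs)"
    and "invertible (J xs)"
    and "prob_space P"
    and "random_broyden P F J x0 B0 u x B"
    and "AE \<omega> in P. \<forall>k. invertible (B k \<omega>)"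
    and "48 * sqrt n * c * M * norm (x0 - xs) + c * spectral_norm (B0 - J x0) \<le> 1 / 3"
    and "0 < \<delta>" and "\<delta> < 1"
  shows "measure P {\<omega> \<in> space P.
      (\<forall>k::nat. k \<ge> 1 \<longrightarrow>
         norm (x k \<omega> - xs) \<le> (4 * n\<^sup>2 * exp 1 / \<delta>) ^ k
           * (1 - 1 / (n + 1)) powr (real k * (real k - 1) / 4) * norm (x0 - xs)) \<and>
      (\<forall>k::nat. real k \<ge> 4 * (n + 1) * ln (4 * n\<^sup>2 * exp 1 / \<delta>) + 3 \<longrightarrow>
         frobenius_norm (B k \<omega> - J xs) \<le> 8 * n\<^sup>2 * inverse c * exp 1 / \<delta>
           * (1 - 1 / (n + 1)) powr (real k / 2))}
    \<ge> 1 - \<delta>"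
proof -
  let ?Z = "\<lambda>k \<omega>. (x k \<omega>, B k \<omega>)"
  interpret L: lipschitz_root F J xs M
    by unfold_locales (use assms in auto)
  have c: "c = L.c" by (simp add: c_def L.c_def)
  have it: "broyden_iterates F J x0 B0 (\<lambda>k. u k \<omega>) (\<lambda>k. x k \<omega>) (\<lambda>k. B k \<omega>)"
    if "\<omega> \<in> space P" for \<omega>
    using assms(10) that by (simp add: random_broyden_def)
  have dirs: "random_directions P u"
    using assms(10) by (simp add: random_broyden_def)
  interpret pr: prob_space P by fact
  interpret U: uniform_recursion P Basis u ?Z "(x0, B0)" "broyden_step F J"
    by unfold_locales
      (use dirs broyden_iterates_step[OF it] in \<open>auto simp: random_directions_def\<close>)
  have init: "L.safe (x0, B0)" "L.potential (x0, B0) \<le> n"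
    using L.initial_errors[of x0 B0] assms(12) by (simp_all add: c n_def)
  have safe: "L.safe (?Z k \<omega>)" if "\<omega> \<in> space P" for k \<omega>
    using L.broyden_iterates_safe[OF it[OF that] U.draw_in[OF that] init(1)] .
  \<comment> \<open>The square of \<open>a\<close> is the Markov level. The tail bound below evaluates to
      \<open>n \<cdot> n\<^sup>2 / a\<^sup>2 = \<delta>\<^sup>2 / n\<close>, well below \<open>\<delta>\<close>.\<close>
  define a where "a = n\<^sup>2 / \<delta>"
  define q where "q = 1 - 1 / n"
  define Q where "Q = 1 - 1 / (n + 1)"
  have n: "2 \<le> n" using assms(3) by (simp add: n_def)
  have q: "0 \<le> q" "q < Q" "0 < Q"
    using n by (simp_all add: q_def Q_def field_simps)
  have a: "0 < a" using n assms by (simp add: a_def)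
  have drift: "(\<Sum>b\<in>Basis. L.potential (broyden_step F J (?Z k \<omega>) b))
      \<le> real (card (Basis :: (real ^ 'n) set)) * q * L.potential (?Z k \<omega>)" if "\<omega> \<in> space P" for k \<omega>
  proof -
    have "real (card (Basis :: (real ^ 'n) set)) * q = real (CARD('n) - 1)"
      using n assms(3) by (simp add: q_def n_def of_nat_diff field_simps)
    then show ?thesis
      using L.sum_potential_broyden_step[OF safe[OF that] assms(3), of k] by simp
  qed
  define bad where "bad = {\<omega> \<in> space P. \<exists>k. a\<^sup>2 * Q ^ k \<le> L.potential (?Z k \<omega>)}"
  have tail: "bad \<in> sets P"
      "measure P bad \<le> L.potential (x0, B0) / (a\<^sup>2 * (1 - q / Q))"
    unfolding bad_def
    by (rule U.prob_exceed_geometric[OF drift]; use q a L.potential_nonneg in simp)+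
  have "1 - q / Q = 1 / n\<^sup>2"
    using n by (simp add: q_def Q_def field_simps power2_eq_square)
  then have "L.potential (x0, B0) / (a\<^sup>2 * (1 - q / Q)) \<le> n / (a\<^sup>2 * (1 / n\<^sup>2))"
    using init(2) n by (simp add: divide_right_mono)
  also have "\<dots> = \<delta> * (\<delta> / n)"
    using n assms(13) by (simp add: a_def field_simps power2_eq_square)
  also have "\<dots> \<le> \<delta> * 1"
    using n assms(13,14) by (intro mult_left_mono) auto
  finally have bad_le: "measure P bad \<le> \<delta>"
    using tail(2) by simp
  define good where "good = {\<omega> \<in> space P.
      (\<forall>k::nat. k \<ge> 1 \<longrightarrow>
         norm (x k \<omega> - xs) \<le> (4 * n\<^sup>2 * exp 1 / \<delta>) ^ k
           * Q powr (real k * (real k - 1) / 4) * norm (x0 - xs)) \<and>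
      (\<forall>k::nat. real k \<ge> 4 * (n + 1) * ln (4 * n\<^sup>2 * exp 1 / \<delta>) + 3 \<longrightarrow>
         frobenius_norm (B k \<omega> - J xs) \<le> 8 * n\<^sup>2 * inverse c * exp 1 / \<delta>
           * Q powr (real k / 2))}"
  have "(\<lambda>\<omega>. norm (x k \<omega> - xs)) \<in> borel_measurable P"
    and "(\<lambda>\<omega>. frobenius_norm (B k \<omega> - J xs)) \<in> borel_measurable P" for k
    using U.borel_measurable_state[of "\<lambda>z. norm (fst z - xs)" k]
      U.borel_measurable_state[of "\<lambda>z. frobenius_norm (snd z - J xs)" k] by simp_all
  then have good: "good \<in> sets P"
    unfolding good_def by measurable
  have "space P - bad \<subseteq> good"
  proof
    fix \<omega> assume "\<omega> \<in> space P - bad"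
    then have w: "\<omega> \<in> space P" and pot: "L.potential (?Z k \<omega>) \<le> a\<^sup>2 * Q ^ k" for k
      by (auto simp: bad_def not_le less_imp_le)
    have e: "1 \<le> exp (1::real)" by simp
    have a_e: "a \<le> a * exp 1"
      using mult_left_mono[OF e, of a] a by simp
    have "norm (x k \<omega> - xs) \<le> (4 * n\<^sup>2 * exp 1 / \<delta>) ^ k
           * Q powr (real k * (real k - 1) / 4) * norm (x0 - xs)" for k
    proof -
      have "norm (x k \<omega> - xs) \<le> (3 * a) ^ k * Q powr (real k * (real k - 1) / 4) * norm (x0 - xs)"
        using L.iterate_bound_of_potential[OF it[OF w] safe[OF w] q(3) less_imp_le[OF a] pot] .
      also have "\<dots> \<le> (4 * (a * exp 1)) ^ k * Q powr (real k * (real k - 1) / 4) * norm (x0 - xs)"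
      proof (intro mult_right_mono power_mono)
        show "3 * a \<le> 4 * (a * exp 1)" using a a_e by linarith
      qed (use a in auto)
      also have "4 * (a * exp 1) = 4 * n\<^sup>2 * exp 1 / \<delta>"
        by (simp add: a_def)
      finally show ?thesis .
    qed
    moreover have "frobenius_norm (B k \<omega> - J xs) \<le> 8 * n\<^sup>2 * inverse c * exp 1 / \<delta>
           * Q powr (real k / 2)" for k
    proof -
      have "frobenius_norm (B k \<omega> - J xs) \<le> a / c * Q powr (real k / 2)"
        unfolding frobenius_norm_eq_norm c
        using L.matrix_bound_of_potential[OF q(3) less_imp_le[OF a] pot] .
      also have "\<dots> \<le> (8 * (a * exp 1)) / c * Q powr (real k / 2)"
      proof (intro mult_right_mono divide_right_mono)
        show "a \<le> 8 * (a * exp 1)" using a a_e by linarith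
      qed (use L.c_pos in \<open>auto simp: c\<close>)
      also have "(8 * (a * exp 1)) / c = 8 * n\<^sup>2 * inverse c * exp 1 / \<delta>"
        by (simp add: a_def field_simps)
      finally show ?thesis .
    qed
    ultimately show "\<omega> \<in> good" using w by (simp add: good_def)
  qed
  then have "measure P (space P - bad) \<le> measure P good"
    using good by (rule pr.finite_measure_mono)
  then have "1 - \<delta> \<le> measure P good"
    using pr.prob_compl[OF tail(1)] bad_le by simp
  then show ?thesis by (simp only: good_def Q_def)
qed

end
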